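(* Let $v,z\in\mathbb{K}\setminus\{0\}$ and $\delta\in\mathbb{K}$ with $v^{-1}-v=z(\delta-1)$. The category $\mathcal{C}=\mathcal{C}^{z,z}_{v,1}(+,1,1)$, scaled so that $\varsigma=1$ and $a=1$, is isomorphic (as a strict monoidal category) to the BWM-category $\mathcal{B}$ with parameters $v,z,\delta$.
   Context: $\mathbb{K}$ is a field of characteristic different from 2; everything is $\mathbb{K}$-linear. Both categories are strict monoidal categories (no odd morphisms) with one generating object $\bullet$; $m$ denotes $\bullet^{\otimes m}$, $I$ the identity of $\bullet$, $1_2$ the identity of $\bullet^{\otimes2}$. $H\in\mathrm{Hom}(2,2)$ is the over-cross, $A\in\mathrm{Hom}(2,0)$ the cap, $U\in\mathrm{Hom}(0,2)$ the cup. The category $\mathcal{C}$ is generated by $H$ (invertible), $A$, $U$ subject to: $HU=vU$, $AH=vA$; $AU=\delta$; $(A\otimes I)(I\otimes U)=I=(I\otimes A)(U\otimes I)$; $(A\otimes I)(I\otimes H)(U\otimes I)=v^{-1}I$; $H^2=1_2+zH-zv\,UA$; $(H\otimes I)(I\otimes U)=-z(U\otimes I)+(I\otimes H)(U\otimes I)+z(I\otimes U)$; $(H\otimes I)(I\otimes H)(U\otimes I)=I\otimes U$; $(I\otimes A)(H\otimes I)=-z(A\otimes I)+(A\otimes I)(I\otimes H)+z(I\otimes A)$; $(A\otimes I)(I\otimes H)(H\otimes I)=I\otimes A$; $(H\otimes I)(I\otimes H)(H\otimes I)=(I\otimes H)(H\otimes I)(I\otimes H)$. (These are the defining relations of the category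 of Brauer type with $\lambda=\lambda'=v$, $\varsigma=\varsigma'=1$, $a=1$, $b=f=f'=z$, $c=-zv$, $\rho=v^{-1}$, $d=d'=-z$, $e=e'=1$, $D=E=D'=E'=0$, $F=F'=1$.) The BWM-category $\mathcal{B}$ is generated by $H$, $\bar H\in\mathrm{Hom}(2,2)$ (under-cross), $A$, $U$ subject to: (1) $H-\bar H=z\,1_2-z\,UA$; (2) $AU=\delta$; (3) $HU=vU$, $AH=vA$; (4) $H\bar H=1_2=\bar HH$ and $(H\otimes I)(I\otimes H)(H\otimes I)=(I\otimes H)(H\otimes I)(I\otimes H)$; (5) $(A\otimes I)(I\otimes U)=I$, $(I\otimes A)(U\otimes I)=I$; (6) $(H\otimes I)(I\otimes H)(U\otimes I)=I\otimes U$ and $(I\otimes H)(H\otimes I)(I\otimes U)=U\otimes I$; (7) $(A\otimes I)(I\otimes H)(U\otimes I)=v^{-1}I$ and $(I\otimes A)(H\otimes I)(I\otimes U)=v^{-1}I$. *)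

theory Defs
  imports Complex_Main
begin

section \<open>Strict linear monoidal categories\<close>

record ('o, 'm, 'k) lin_mon_cat =
  Obj :: "'o set"
  Hom :: "'o \<Rightarrow> 'o \<Rightarrow> 'm set"
  unit_obj :: 'o
  tensor_obj :: "'o \<Rightarrow> 'o \<Rightarrow> 'o"
  ident :: "'o \<Rightarrow> 'm"
  compose :: "'m \<Rightarrow> 'm \<Rightarrow> 'm"
  tensor :: "'m \<Rightarrow> 'm \<Rightarrow> 'm"
  hom_zero :: "'o \<Rightarrow> 'o \<Rightarrow> 'm"
  hom_add :: "'m \<Rightarrow> 'm \<Rightarrow> 'm"
  hom_scale :: "'k \<Rightarrow> 'm \<Rightarrow> 'm"

text \<open>
  \<open>compose C g f\<close> is $g \circ f$, i.e. \<open>f\<close> is applied first.  The operations on morphisms are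
  only constrained on (composable) elements of the Hom-sets of objects of the category.
\<close>

locale strict_linear_monoidal_category =
  fixes C :: "('o, 'm, 'k::field) lin_mon_cat"
  assumes unit_obj: "unit_obj C \<in> Obj C"
    and tensor_obj: "\<lbrakk>a \<in> Obj C; b \<in> Obj C\<rbrakk> \<Longrightarrow> tensor_obj C a b \<in> Obj C"
    and tensor_obj_assoc: "\<lbrakk>a \<in> Obj C; b \<in> Obj C; c \<in> Obj C\<rbrakk> \<Longrightarrow>
          tensor_obj C (tensor_obj C a b) c = tensor_obj C a (tensor_obj C b c)"
    and tensor_obj_unit: "a \<in> Obj C \<Longrightarrow> tensor_obj C (unit_obj C) a = a"
          "a \<in> Obj C \<Longrightarrow> tensor_obj C a (unit_obj C) = a"
    and hom_disjoint: "\<lbrakk>a \<in> Obj C; b \<in> Obj C; a' \<in> Obj C; b' \<in> Obj C;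
          f \<in> Hom C a b; f \<in> Hom C a' b'\<rbrakk> \<Longrightarrow> a = a' \<and> b = b'"
    and ident: "a \<in> Obj C \<Longrightarrow> ident C a \<in> Hom C a a"
    and compose: "\<lbrakk>a \<in> Obj C; b \<in> Obj C; c \<in> Obj C; f \<in> Hom C a b; g \<in> Hom C b c\<rbrakk> \<Longrightarrow>
          compose C g f \<in> Hom C a c"
    and compose_ident: "\<lbrakk>a \<in> Obj C; b \<in> Obj C; f \<in> Hom C a b\<rbrakk> \<Longrightarrow> compose C (ident C b) f = f"
          "\<lbrakk>a \<in> Obj C; b \<in> Obj C; f \<in> Hom C a b\<rbrakk> \<Longrightarrow> compose C f (ident C a) = f"
    and compose_assoc: "\<lbrakk>a \<in> Obj C; b \<in> Obj C; c \<in> Obj C; d \<in> Obj C;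
          f \<in> Hom C a b; g \<in> Hom C b c; h \<in> Hom C c d\<rbrakk> \<Longrightarrow>
          compose C (compose C h g) f = compose C h (compose C g f)"
    and tensor: "\<lbrakk>a \<in> Obj C; b \<in> Obj C; a' \<in> Obj C; b' \<in> Obj C;
          f \<in> Hom C a b; g \<in> Hom C a' b'\<rbrakk> \<Longrightarrow>
          tensor C f g \<in> Hom C (tensor_obj C a a') (tensor_obj C b b')"
    and tensor_ident: "\<lbrakk>a \<in> Obj C; b \<in> Obj C\<rbrakk> \<Longrightarrow>
          tensor C (ident C a) (ident C b) = ident C (tensor_obj C a b)"
    and interchange: "\<lbrakk>a \<in> Obj C; b \<in> Obj C; c \<in> Obj C; a' \<in> Obj C; b' \<in> Obj C; c' \<in> Obj C;
          f \<in> Hom C a b; g \<in> Hom C b c; f' \<in> Hom C a' b'; g' \<in> Hom C b' c'\<rbrakk> \<Longrightarrow>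
          compose C (tensor C g g') (tensor C f f') = tensor C (compose C g f) (compose C g' f')"
    and tensor_assoc: "\<lbrakk>a \<in> Obj C; b \<in> Obj C; a' \<in> Obj C; b' \<in> Obj C; a'' \<in> Obj C; b'' \<in> Obj C;
          f \<in> Hom C a b; g \<in> Hom C a' b'; h \<in> Hom C a'' b''\<rbrakk> \<Longrightarrow>
          tensor C (tensor C f g) h = tensor C f (tensor C g h)"
    and tensor_unit: "\<lbrakk>a \<in> Obj C; b \<in> Obj C; f \<in> Hom C a b\<rbrakk> \<Longrightarrow>
          tensor C (ident C (unit_obj C)) f = f"
          "\<lbrakk>a \<in> Obj C; b \<in> Obj C; f \<in> Hom C a b\<rbrakk> \<Longrightarrow> tensor C f (ident C (unit_obj C)) = f"
    and hom_zero: "\<lbrakk>a \<in> Obj C; b \<in> Obj C\<rbrakk> \<Longrightarrow> hom_zero C a b \<in> Hom C a b"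
    and hom_add: "\<lbrakk>a \<in> Obj C; b \<in> Obj C; f \<in> Hom C a b; g \<in> Hom C a b\<rbrakk> \<Longrightarrow>
          hom_add C f g \<in> Hom C a b"
    and hom_scale: "\<lbrakk>a \<in> Obj C; b \<in> Obj C; f \<in> Hom C a b\<rbrakk> \<Longrightarrow> hom_scale C x f \<in> Hom C a b"
    and hom_add_assoc: "\<lbrakk>a \<in> Obj C; b \<in> Obj C; f \<in> Hom C a b; g \<in> Hom C a b; h \<in> Hom C a b\<rbrakk> \<Longrightarrow>
          hom_add C (hom_add C f g) h = hom_add C f (hom_add C g h)"
    and hom_add_commute: "\<lbrakk>a \<in> Obj C; b \<in> Obj C; f \<in> Hom C a b; g \<in> Hom C a b\<rbrakk> \<Longrightarrow>
          hom_add C f g = hom_add C g f"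
    and hom_add_zero: "\<lbrakk>a \<in> Obj C; b \<in> Obj C; f \<in> Hom C a b\<rbrakk> \<Longrightarrow>
          hom_add C f (hom_zero C a b) = f"
    and hom_add_inverse: "\<lbrakk>a \<in> Obj C; b \<in> Obj C; f \<in> Hom C a b\<rbrakk> \<Longrightarrow>
          \<exists>g \<in> Hom C a b. hom_add C f g = hom_zero C a b"
    and hom_scale_add: "\<lbrakk>a \<in> Obj C; b \<in> Obj C; f \<in> Hom C a b; g \<in> Hom C a b\<rbrakk> \<Longrightarrow>
          hom_scale C x (hom_add C f g) = hom_add C (hom_scale C x f) (hom_scale C x g)"
          "\<lbrakk>a \<in> Obj C; b \<in> Obj C; f \<in> Hom C a b\<rbrakk> \<Longrightarrow>
          hom_scale C (x + y) f = hom_add C (hom_scale C x f) (hom_scale C y f)"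
    and hom_scale_scale: "\<lbrakk>a \<in> Obj C; b \<in> Obj C; f \<in> Hom C a b\<rbrakk> \<Longrightarrow>
          hom_scale C x (hom_scale C y f) = hom_scale C (x * y) f"
    and hom_scale_one: "\<lbrakk>a \<in> Obj C; b \<in> Obj C; f \<in> Hom C a b\<rbrakk> \<Longrightarrow> hom_scale C 1 f = f"
    and compose_add: "\<lbrakk>a \<in> Obj C; b \<in> Obj C; c \<in> Obj C;
          f \<in> Hom C a b; f' \<in> Hom C a b; g \<in> Hom C b c\<rbrakk> \<Longrightarrow>
          compose C g (hom_add C f f') = hom_add C (compose C g f) (compose C g f')"
          "\<lbrakk>a \<in> Obj C; b \<in> Obj C; c \<in> Obj C;
          f \<in> Hom C a b; g \<in> Hom C b c; g' \<in> Hom C b c\<rbrakk> \<Longrightarrow>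
          compose C (hom_add C g g') f = hom_add C (compose C g f) (compose C g' f)"
    and compose_scale: "\<lbrakk>a \<in> Obj C; b \<in> Obj C; c \<in> Obj C; f \<in> Hom C a b; g \<in> Hom C b c\<rbrakk> \<Longrightarrow>
          compose C g (hom_scale C x f) = hom_scale C x (compose C g f)"
          "\<lbrakk>a \<in> Obj C; b \<in> Obj C; c \<in> Obj C; f \<in> Hom C a b; g \<in> Hom C b c\<rbrakk> \<Longrightarrow>
          compose C (hom_scale C x g) f = hom_scale C x (compose C g f)"
    and tensor_add: "\<lbrakk>a \<in> Obj C; b \<in> Obj C; a' \<in> Obj C; b' \<in> Obj C;
          f \<in> Hom C a b; g \<in> Hom C a' b'; g' \<in> Hom C a' b'\<rbrakk> \<Longrightarrow>
          tensor C f (hom_add C g g') = hom_add C (tensor C f g) (tensor C f g')"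
          "\<lbrakk>a \<in> Obj C; b \<in> Obj C; a' \<in> Obj C; b' \<in> Obj C;
          f \<in> Hom C a b; f' \<in> Hom C a b; g \<in> Hom C a' b'\<rbrakk> \<Longrightarrow>
          tensor C (hom_add C f f') g = hom_add C (tensor C f g) (tensor C f' g)"
    and tensor_scale: "\<lbrakk>a \<in> Obj C; b \<in> Obj C; a' \<in> Obj C; b' \<in> Obj C;
          f \<in> Hom C a b; g \<in> Hom C a' b'\<rbrakk> \<Longrightarrow>
          tensor C f (hom_scale C x g) = hom_scale C x (tensor C f g)"
          "\<lbrakk>a \<in> Obj C; b \<in> Obj C; a' \<in> Obj C; b' \<in> Obj C;
          f \<in> Hom C a b; g \<in> Hom C a' b'\<rbrakk> \<Longrightarrow>
          tensor C (hom_scale C x f) g = hom_scale C x (tensor C f g)"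

locale strict_linear_monoidal_functor =
  source: strict_linear_monoidal_category C + target: strict_linear_monoidal_category D
  for C :: "('o, 'm, 'k::field) lin_mon_cat" and D :: "('p, 'n, 'k) lin_mon_cat" +
  fixes F0 :: "'o \<Rightarrow> 'p" and F1 :: "'m \<Rightarrow> 'n"
  assumes obj: "a \<in> Obj C \<Longrightarrow> F0 a \<in> Obj D"
    and obj_unit: "F0 (unit_obj C) = unit_obj D"
    and obj_tensor: "\<lbrakk>a \<in> Obj C; b \<in> Obj C\<rbrakk> \<Longrightarrow> F0 (tensor_obj C a b) = tensor_obj D (F0 a) (F0 b)"
    and hom: "\<lbrakk>a \<in> Obj C; b \<in> Obj C; f \<in> Hom C a b\<rbrakk> \<Longrightarrow> F1 f \<in> Hom D (F0 a) (F0 b)"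
    and hom_ident: "a \<in> Obj C \<Longrightarrow> F1 (ident C a) = ident D (F0 a)"
    and hom_compose: "\<lbrakk>a \<in> Obj C; b \<in> Obj C; c \<in> Obj C; f \<in> Hom C a b; g \<in> Hom C b c\<rbrakk> \<Longrightarrow>
          F1 (compose C g f) = compose D (F1 g) (F1 f)"
    and hom_tensor: "\<lbrakk>a \<in> Obj C; b \<in> Obj C; a' \<in> Obj C; b' \<in> Obj C;
          f \<in> Hom C a b; g \<in> Hom C a' b'\<rbrakk> \<Longrightarrow> F1 (tensor C f g) = tensor D (F1 f) (F1 g)"
    and hom_add: "\<lbrakk>a \<in> Obj C; b \<in> Obj C; f \<in> Hom C a b; g \<in> Hom C a b\<rbrakk> \<Longrightarrow>
          F1 (hom_add C f g) = hom_add D (F1 f) (F1 g)"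
    and hom_scale: "\<lbrakk>a \<in> Obj C; b \<in> Obj C; f \<in> Hom C a b\<rbrakk> \<Longrightarrow>
          F1 (hom_scale C x f) = hom_scale D x (F1 f)"

definition strict_monoidal_isomorphic ::
    "('o, 'm, 'k::field) lin_mon_cat \<Rightarrow> ('p, 'n, 'k) lin_mon_cat \<Rightarrow> bool" where
  "strict_monoidal_isomorphic C D \<longleftrightarrow>
     (\<exists>F0 F1 G0 G1.
        strict_linear_monoidal_functor C D F0 F1 \<and>
        strict_linear_monoidal_functor D C G0 G1 \<and>
        (\<forall>a \<in> Obj C. G0 (F0 a) = a) \<and>
        (\<forall>a \<in> Obj D. F0 (G0 a) = a) \<and>
        (\<forall>a \<in> Obj C. \<forall>b \<in> Obj C. \<forall>f \<in> Hom C a b. G1 (F1 f) = f) \<and>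
        (\<forall>a \<in> Obj D. \<forall>b \<in> Obj D. \<forall>f \<in> Hom D a b. F1 (G1 f) = f))"


section \<open>Presentations with one generating object\<close>

text \<open>
  The objects are the natural numbers, \<open>n\<close> standing for the \<open>n\<close>-th tensor power of the generating
  object.  Morphisms are formal expressions modulo the least congruence that contains the given
  relations and the axioms of a strict linear monoidal category.
\<close>

datatype ('g, 'k) mterm =
    Gen 'g
  | Idt nat
  | Comp "('g, 'k) mterm" "('g, 'k) mterm"  (infixl \<open>\<cdot>\<close> 70)
  | Tens "('g, 'k) mterm" "('g, 'k) mterm"  (infixl \<open>\<otimes>\<close> 75)
  | Zero nat nat
  | Add "('g, 'k) mterm" "('g, 'k) mterm"  (infixl \<open>\<oplus>\<close> 65)
  | Scale 'k "('g, 'k) mterm"  (infixr \<open>\<odot>\<close> 68)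

record ('g, 'k) presentation =
  gen_source :: "'g \<Rightarrow> nat"
  gen_target :: "'g \<Rightarrow> nat"
  relations :: "(('g, 'k) mterm \<times> ('g, 'k) mterm) set"

inductive typed :: "('g, 'k, 'e) presentation_scheme \<Rightarrow> ('g, 'k) mterm \<Rightarrow> nat \<Rightarrow> nat \<Rightarrow> bool"
  for P where
  "typed P (Gen x) (gen_source P x) (gen_target P x)"
| "typed P (Idt n) n n"
| "typed P f l m \<Longrightarrow> typed P g m n \<Longrightarrow> typed P (g \<cdot> f) l n"
| "typed P f m n \<Longrightarrow> typed P f' m' n' \<Longrightarrow> typed P (f \<otimes> f') (m + m') (n + n')"
| "typed P (Zero m n) m n"
| "typed P f m n \<Longrightarrow> typed P g m n \<Longrightarrow> typed P (f \<oplus> g) m n"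
| "typed P f m n \<Longrightarrow> typed P (x \<odot> f) m n"

text \<open>\<open>mor_eq P m n f g\<close>: the expressions \<open>f\<close> and \<open>g\<close> denote the same morphism from \<open>m\<close> to \<open>n\<close>.\<close>

inductive mor_eq ::
    "('g, 'k::field, 'e) presentation_scheme \<Rightarrow> nat \<Rightarrow> nat \<Rightarrow> ('g, 'k) mterm \<Rightarrow> ('g, 'k) mterm \<Rightarrow> bool"
  for P where
  mor_relation: "(f, g) \<in> relations P \<Longrightarrow> typed P f m n \<Longrightarrow> typed P g m n \<Longrightarrow> mor_eq P m n f g"
\<comment> \<open>congruence\<close>
| mor_refl: "typed P f m n \<Longrightarrow> mor_eq P m n f f"
| mor_sym: "mor_eq P m n f g \<Longrightarrow> mor_eq P m n g f"
| mor_trans: "mor_eq P m n f g \<Longrightarrow> mor_eq P m n g h \<Longrightarrow> mor_eq P m n f h"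
| mor_comp_cong: "mor_eq P l m f f' \<Longrightarrow> mor_eq P m n g g' \<Longrightarrow> mor_eq P l n (g \<cdot> f) (g' \<cdot> f')"
| mor_tens_cong: "mor_eq P m n f f' \<Longrightarrow> mor_eq P m' n' g g' \<Longrightarrow>
    mor_eq P (m + m') (n + n') (f \<otimes> g) (f' \<otimes> g')"
| mor_add_cong: "mor_eq P m n f f' \<Longrightarrow> mor_eq P m n g g' \<Longrightarrow> mor_eq P m n (f \<oplus> g) (f' \<oplus> g')"
| mor_scale_cong: "mor_eq P m n f f' \<Longrightarrow> mor_eq P m n (x \<odot> f) (x \<odot> f')"
\<comment> \<open>category\<close>
| mor_comp_id_left: "typed P f m n \<Longrightarrow> mor_eq P m n (Idt n \<cdot> f) f"
| mor_comp_id_right: "typed P f m n \<Longrightarrow> mor_eq P m n (f \<cdot> Idt m) f"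
| mor_comp_assoc: "typed P f k l \<Longrightarrow> typed P g l m \<Longrightarrow> typed P h m n \<Longrightarrow>
    mor_eq P k n (h \<cdot> g \<cdot> f) (h \<cdot> (g \<cdot> f))"
\<comment> \<open>strict monoidal structure\<close>
| mor_tens_id: "mor_eq P (m + n) (m + n) (Idt m \<otimes> Idt n) (Idt (m + n))"
| mor_interchange: "typed P f l m \<Longrightarrow> typed P g m n \<Longrightarrow> typed P f' l' m' \<Longrightarrow> typed P g' m' n' \<Longrightarrow>
    mor_eq P (l + l') (n + n') ((g \<otimes> g') \<cdot> (f \<otimes> f')) ((g \<cdot> f) \<otimes> (g' \<cdot> f'))"
| mor_tens_assoc: "typed P f m n \<Longrightarrow> typed P f' m' n' \<Longrightarrow> typed P f'' m'' n'' \<Longrightarrow>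
    mor_eq P (m + m' + m'') (n + n' + n'') (f \<otimes> f' \<otimes> f'') (f \<otimes> (f' \<otimes> f''))"
| mor_tens_unit_left: "typed P f m n \<Longrightarrow> mor_eq P m n (Idt 0 \<otimes> f) f"
| mor_tens_unit_right: "typed P f m n \<Longrightarrow> mor_eq P m n (f \<otimes> Idt 0) f"
\<comment> \<open>vector space structure on Hom-sets\<close>
| mor_add_assoc: "typed P f m n \<Longrightarrow> typed P g m n \<Longrightarrow> typed P h m n \<Longrightarrow>
    mor_eq P m n (f \<oplus> g \<oplus> h) (f \<oplus> (g \<oplus> h))"
| mor_add_commute: "typed P f m n \<Longrightarrow> typed P g m n \<Longrightarrow> mor_eq P m n (f \<oplus> g) (g \<oplus> f)"
| mor_add_zero: "typed P f m n \<Longrightarrow> mor_eq P m n (f \<oplus> Zero m n) f"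
| mor_add_minus: "typed P f m n \<Longrightarrow> mor_eq P m n (f \<oplus> (- 1) \<odot> f) (Zero m n)"
| mor_scale_add_right: "typed P f m n \<Longrightarrow> typed P g m n \<Longrightarrow>
    mor_eq P m n (x \<odot> (f \<oplus> g)) (x \<odot> f \<oplus> x \<odot> g)"
| mor_scale_add_left: "typed P f m n \<Longrightarrow> mor_eq P m n ((x + y) \<odot> f) (x \<odot> f \<oplus> y \<odot> f)"
| mor_scale_scale: "typed P f m n \<Longrightarrow> mor_eq P m n (x \<odot> y \<odot> f) ((x * y) \<odot> f)"
| mor_scale_one: "typed P f m n \<Longrightarrow> mor_eq P m n (1 \<odot> f) f"
\<comment> \<open>bilinearity of composition and tensor product\<close>
| mor_comp_add_right: "typed P f l m \<Longrightarrow> typed P f' l m \<Longrightarrow> typed P g m n \<Longrightarrow>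
    mor_eq P l n (g \<cdot> (f \<oplus> f')) (g \<cdot> f \<oplus> g \<cdot> f')"
| mor_comp_add_left: "typed P f l m \<Longrightarrow> typed P g m n \<Longrightarrow> typed P g' m n \<Longrightarrow>
    mor_eq P l n ((g \<oplus> g') \<cdot> f) (g \<cdot> f \<oplus> g' \<cdot> f)"
| mor_comp_scale_right: "typed P f l m \<Longrightarrow> typed P g m n \<Longrightarrow>
    mor_eq P l n (g \<cdot> (x \<odot> f)) (x \<odot> (g \<cdot> f))"
| mor_comp_scale_left: "typed P f l m \<Longrightarrow> typed P g m n \<Longrightarrow>
    mor_eq P l n ((x \<odot> g) \<cdot> f) (x \<odot> (g \<cdot> f))"
| mor_tens_add_right: "typed P f m n \<Longrightarrow> typed P g m' n' \<Longrightarrow> typed P g' m' n' \<Longrightarrow>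
    mor_eq P (m + m') (n + n') (f \<otimes> (g \<oplus> g')) (f \<otimes> g \<oplus> f \<otimes> g')"
| mor_tens_add_left: "typed P f m n \<Longrightarrow> typed P f' m n \<Longrightarrow> typed P g m' n' \<Longrightarrow>
    mor_eq P (m + m') (n + n') ((f \<oplus> f') \<otimes> g) (f \<otimes> g \<oplus> f' \<otimes> g)"
| mor_tens_scale_right: "typed P f m n \<Longrightarrow> typed P g m' n' \<Longrightarrow>
    mor_eq P (m + m') (n + n') (f \<otimes> (x \<odot> g)) (x \<odot> (f \<otimes> g))"
| mor_tens_scale_left: "typed P f m n \<Longrightarrow> typed P g m' n' \<Longrightarrow>
    mor_eq P (m + m') (n + n') ((x \<odot> f) \<otimes> g) (x \<odot> (f \<otimes> g))"

definition mor_class ::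
    "('g, 'k::field, 'e) presentation_scheme \<Rightarrow> ('g, 'k) mterm \<Rightarrow> ('g, 'k) mterm set" where
  "mor_class P f = {g. \<exists>m n. mor_eq P m n f g}"

definition presented_category ::
    "('g, 'k::field, 'e) presentation_scheme \<Rightarrow> (nat, ('g, 'k) mterm set, 'k) lin_mon_cat" where
  "presented_category P = \<lparr>
     Obj = UNIV,
     Hom = (\<lambda>m n. {mor_class P f | f. typed P f m n}),
     unit_obj = 0,
     tensor_obj = (+),
     ident = (\<lambda>n. mor_class P (Idt n)),
     compose = (\<lambda>X Y. \<Union>g \<in> X. \<Union>f \<in> Y. mor_class P (g \<cdot> f)),
     tensor = (\<lambda>X Y. \<Union>f \<in> X. \<Union>g \<in> Y. mor_class P (f \<otimes> g)),
     hom_zero = (\<lambda>m n. mor_class P (Zero m n)),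
     hom_add = (\<lambda>X Y. \<Union>f \<in> X. \<Union>g \<in> Y. mor_class P (f \<oplus> g)),
     hom_scale = (\<lambda>x X. \<Union>f \<in> X. mor_class P (x \<odot> f))\<rparr>"

inductive_cases typed_elims [elim]:
  "typed P (Gen x) m n" "typed P (Idt k) m n" "typed P (g \<cdot> f) m n" "typed P (f \<otimes> g) m n"
  "typed P (Zero k l) m n" "typed P (f \<oplus> g) m n" "typed P (x \<odot> f) m n"

primrec term_source :: "('g, 'k, 'e) presentation_scheme \<Rightarrow> ('g, 'k) mterm \<Rightarrow> nat" where
  "term_source P (Gen x) = gen_source P x"
| "term_source P (Idt n) = n"
| "term_source P (g \<cdot> f) = term_source P f"
| "term_source P (f \<otimes> g) = term_source P f + term_source P g"
| "term_source P (Zero m n) = m"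
| "term_source P (f \<oplus> g) = term_source P f"
| "term_source P (x \<odot> f) = term_source P f"

primrec term_target :: "('g, 'k, 'e) presentation_scheme \<Rightarrow> ('g, 'k) mterm \<Rightarrow> nat" where
  "term_target P (Gen x) = gen_target P x"
| "term_target P (Idt n) = n"
| "term_target P (g \<cdot> f) = term_target P g"
| "term_target P (f \<otimes> g) = term_target P f + term_target P g"
| "term_target P (Zero m n) = n"
| "term_target P (f \<oplus> g) = term_target P f"
| "term_target P (x \<odot> f) = term_target P f"

primrec well_formed :: "('g, 'k, 'e) presentation_scheme \<Rightarrow> ('g, 'k) mterm \<Rightarrow> bool" where
  "well_formed P (Gen x) \<longleftrightarrow> True"
| "well_formed P (Idt n) \<longleftrightarrow> True"
| "well_formed P (g \<cdot> f) \<longleftrightarrow> well_formed P f \<and> well_formed P g \<and> term_target P f = term_source P g"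
| "well_formed P (f \<otimes> g) \<longleftrightarrow> well_formed P f \<and> well_formed P g"
| "well_formed P (Zero m n) \<longleftrightarrow> True"
| "well_formed P (f \<oplus> g) \<longleftrightarrow> well_formed P f \<and> well_formed P g \<and>
     term_source P f = term_source P g \<and> term_target P f = term_target P g"
| "well_formed P (x \<odot> f) \<longleftrightarrow> well_formed P f"

lemma typed_iff: "typed P f m n \<longleftrightarrow> well_formed P f \<and> m = term_source P f \<and> n = term_target P f"
proof
  show "typed P f m n \<Longrightarrow> well_formed P f \<and> m = term_source P f \<and> n = term_target P f"
    by (induction rule: typed.induct) auto
next
  have "well_formed P f \<Longrightarrow> typed P f (term_source P f) (term_target P f)"
    by (induction f) (auto intro: typed.intros)
  then show "well_formed P f \<and> m = term_source P f \<and> n = term_target P f \<Longrightarrow> typed P f m n"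
    by blast
qed

lemma typed_unique: "typed P f m n \<Longrightarrow> typed P f m' n' \<Longrightarrow> m = m' \<and> n = n'"
  by (induction arbitrary: m' n' rule: typed.induct) blast+

lemma mor_eq_typed: "mor_eq P m n f g \<Longrightarrow> typed P f m n \<and> typed P g m n"
proof (induction rule: mor_eq.induct)
  case (mor_tens_assoc f m n f' m' n' f'' m'' n'')
  then show ?case by (metis typed.intros(4) add.assoc)
next
  case (mor_tens_unit_left f m n)
  then show ?case by (metis typed.intros(2,4) add_0)
next
  case (mor_tens_unit_right f m n)
  then show ?case by (metis typed.intros(2,4) add_0_right)
qed (auto intro: typed.intros)

lemma mem_mor_class:
  assumes "typed P f m n"
  shows "g \<in> mor_class P f \<longleftrightarrow> mor_eq P m n f g"
  using assms mor_eq_typed typed_unique unfolding mor_class_def by blast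

lemma mor_class_eq_iff:
  assumes "typed P f m n"
  shows "mor_class P f = mor_class P g \<longleftrightarrow> mor_eq P m n f g"
proof
  assume "mor_class P f = mor_class P g"
  moreover have "f \<in> mor_class P f"
    using assms mem_mor_class mor_eq.mor_refl by blast
  ultimately obtain m' n' where "mor_eq P m' n' g f"
    unfolding mor_class_def by blast
  then show "mor_eq P m n f g"
    using assms mor_eq_typed typed_unique mor_eq.mor_sym by metis
next
  assume *: "mor_eq P m n f g"
  then have "typed P g m n" using mor_eq_typed by blast
  then show "mor_class P f = mor_class P g"
    using assms * by (auto simp: mem_mor_class) (metis mor_eq.mor_sym mor_eq.mor_trans)+
qed

lemma mor_class_UN:
  assumes "typed P f m n"
    and "\<And>f'. mor_eq P m n f f' \<Longrightarrow> mor_eq P m' n' (h f) (h f')"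
  shows "(\<Union>f' \<in> mor_class P f. mor_class P (h f')) = mor_class P (h f)"
proof -
  have "mor_class P (h f') = mor_class P (h f)" if "f' \<in> mor_class P f" for f'
    using assms that by (metis mem_mor_class mor_class_eq_iff mor_eq_typed)
  moreover have "f \<in> mor_class P f"
    using assms(1) mem_mor_class mor_eq.mor_refl by blast
  ultimately show ?thesis by blast
qed

lemma mor_class_UN2:
  assumes "typed P f m n" "typed P g k l"
    and "\<And>f' g'. mor_eq P m n f f' \<Longrightarrow> mor_eq P k l g g' \<Longrightarrow> mor_eq P m' n' (h f g) (h f' g')"
  shows "(\<Union>f' \<in> mor_class P f. \<Union>g' \<in> mor_class P g. mor_class P (h f' g')) = mor_class P (h f g)"
proof -
  have "mor_class P (h f' g') = mor_class P (h f g)"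
    if "f' \<in> mor_class P f" "g' \<in> mor_class P g" for f' g'
    using assms that by (metis mem_mor_class mor_class_eq_iff mor_eq_typed)
  moreover have "f \<in> mor_class P f" "g \<in> mor_class P g"
    using assms(1,2) mem_mor_class mor_eq.mor_refl by blast+
  ultimately show ?thesis by blast
qed

lemma presented_category_simps [simp]:
  "Obj (presented_category P) = UNIV"
  "Hom (presented_category P) m n = {mor_class P f | f. typed P f m n}"
  "unit_obj (presented_category P) = 0"
  "tensor_obj (presented_category P) = (+)"
  "ident (presented_category P) n = mor_class P (Idt n)"
  "hom_zero (presented_category P) m n = mor_class P (Zero m n)"
  by (simp_all add: presented_category_def)

lemma presented_category_compose:
  "typed P f l m \<Longrightarrow> typed P g m n \<Longrightarrow>
     compose (presented_category P) (mor_class P g) (mor_class P f) = mor_class P (g \<cdot> f)"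
  by (simp add: presented_category_def) (rule mor_class_UN2, auto intro: mor_eq.mor_comp_cong)

lemma presented_category_tensor:
  "typed P f m n \<Longrightarrow> typed P g m' n' \<Longrightarrow>
     tensor (presented_category P) (mor_class P f) (mor_class P g) = mor_class P (f \<otimes> g)"
  by (simp add: presented_category_def) (rule mor_class_UN2, auto intro: mor_eq.mor_tens_cong)

lemma presented_category_add:
  "typed P f m n \<Longrightarrow> typed P g m n \<Longrightarrow>
     hom_add (presented_category P) (mor_class P f) (mor_class P g) = mor_class P (f \<oplus> g)"
  by (simp add: presented_category_def) (rule mor_class_UN2, auto intro: mor_eq.mor_add_cong)

lemma presented_category_scale:
  "typed P f m n \<Longrightarrow>
     hom_scale (presented_category P) x (mor_class P f) = mor_class P (x \<odot> f)"
  by (simp add: presented_category_def) (rule mor_class_UN, auto intro: mor_eq.mor_scale_cong)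

lemma presented_category_ops:
  "well_formed P f \<Longrightarrow> well_formed P g \<Longrightarrow> term_target P f = term_source P g \<Longrightarrow>
     compose (presented_category P) (mor_class P g) (mor_class P f) = mor_class P (g \<cdot> f)"
  "well_formed P f \<Longrightarrow> well_formed P g \<Longrightarrow>
     tensor (presented_category P) (mor_class P f) (mor_class P g) = mor_class P (f \<otimes> g)"
  "well_formed P f \<Longrightarrow> well_formed P g \<Longrightarrow> term_source P f = term_source P g \<Longrightarrow>
     term_target P f = term_target P g \<Longrightarrow>
     hom_add (presented_category P) (mor_class P f) (mor_class P g) = mor_class P (f \<oplus> g)"
  "well_formed P f \<Longrightarrow>
     hom_scale (presented_category P) x (mor_class P f) = mor_class P (x \<odot> f)"
  by (simp_all add: typed_iff presented_category_compose presented_category_tensor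
        presented_category_add presented_category_scale)

lemma mor_class_eqI: "mor_eq P m n f g \<Longrightarrow> mor_class P f = mor_class P g"
  using mor_class_eq_iff mor_eq_typed by blast

lemma mor_class_eqI':
  "mor_eq P (term_source P f) (term_target P f) f g \<Longrightarrow> mor_class P f = mor_class P g"
  by (rule mor_class_eqI)

lemma presented_category_minus:
  assumes "well_formed P f"
  shows "\<exists>g. (\<exists>h. g = mor_class P h \<and> well_formed P h \<and>
             term_source P f = term_source P h \<and> term_target P f = term_target P h) \<and>
           hom_add (presented_category P) (mor_class P f) g =
           mor_class P (Zero (term_source P f) (term_target P f))"
proof (rule exI [of _ "mor_class P ((- 1) \<odot> f)"], rule conjI)
  show "hom_add (presented_category P) (mor_class P f) (mor_class P ((- 1) \<odot> f)) =
      mor_class P (Zero (term_source P f) (term_target P f))"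
    using assms mor_class_eqI [OF mor_eq.mor_add_minus [of P f]]
    by (simp add: presented_category_ops typed_iff)
qed (rule exI [of _ "(- 1) \<odot> f"], simp add: assms)

theorem presented_category_is_category:
  "strict_linear_monoidal_category (presented_category P)"
  apply (unfold_locales; (clarsimp simp: typed_iff presented_category_ops)?)
                   apply (metis mor_class_eq_iff mor_eq_typed typed_iff)
                  apply ((rule exI, rule conjI, rule refl, simp)
      | erule presented_category_minus
      | rule mor_class_eqI [OF mor_eq.mor_tens_id]
      | (rule mor_class_eqI', simp?, rule mor_eq.intros(9-), (simp add: typed_iff)+))+
  done


section \<open>The category of Brauer type\<close>

datatype brauer_gen = BrH | BrHinv | BrA | BrU

text \<open>
  The category $\mathcal{C}^{z,z}_{v,1}(+,1,1)$, scaled so that $\varsigma = 1$ and $a = 1$.  The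
  formal inverse \<open>brHinv\<close> is adjoined because \<open>brH\<close> is an invertible generator.
\<close>

abbreviation "brH \<equiv> Gen BrH"
abbreviation "brHinv \<equiv> Gen BrHinv"
abbreviation "brA \<equiv> Gen BrA"
abbreviation "brU \<equiv> Gen BrU"

inductive_set brauer_relations ::
    "'k::field \<Rightarrow> 'k \<Rightarrow> 'k \<Rightarrow> ((brauer_gen, 'k) mterm \<times> (brauer_gen, 'k) mterm) set"
  for v z \<delta> :: "'k::field" where
  "(brH \<cdot> brHinv, Idt 2) \<in> brauer_relations v z \<delta>"
| "(brHinv \<cdot> brH, Idt 2) \<in> brauer_relations v z \<delta>"
| "(brH \<cdot> brU, v \<odot> brU) \<in> brauer_relations v z \<delta>"
| "(brA \<cdot> brH, v \<odot> brA) \<in> brauer_relations v z \<delta>"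
| "(brA \<cdot> brU, \<delta> \<odot> Idt 0) \<in> brauer_relations v z \<delta>"
| "((brA \<otimes> Idt 1) \<cdot> (Idt 1 \<otimes> brU), Idt 1) \<in> brauer_relations v z \<delta>"
| "((Idt 1 \<otimes> brA) \<cdot> (brU \<otimes> Idt 1), Idt 1) \<in> brauer_relations v z \<delta>"
| "((brA \<otimes> Idt 1) \<cdot> (Idt 1 \<otimes> brH) \<cdot> (brU \<otimes> Idt 1), inverse v \<odot> Idt 1)
     \<in> brauer_relations v z \<delta>"
| "(brH \<cdot> brH, Idt 2 \<oplus> z \<odot> brH \<oplus> (- (z * v)) \<odot> (brU \<cdot> brA)) \<in> brauer_relations v z \<delta>"
| "((brH \<otimes> Idt 1) \<cdot> (Idt 1 \<otimes> brU),
     (- z) \<odot> (brU \<otimes> Idt 1) \<oplus> (Idt 1 \<otimes> brH) \<cdot> (brU \<otimes> Idt 1) \<oplus> z \<odot> (Idt 1 \<otimes> brU))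
     \<in> brauer_relations v z \<delta>"
| "((brH \<otimes> Idt 1) \<cdot> (Idt 1 \<otimes> brH) \<cdot> (brU \<otimes> Idt 1), Idt 1 \<otimes> brU) \<in> brauer_relations v z \<delta>"
| "((Idt 1 \<otimes> brA) \<cdot> (brH \<otimes> Idt 1),
     (- z) \<odot> (brA \<otimes> Idt 1) \<oplus> (brA \<otimes> Idt 1) \<cdot> (Idt 1 \<otimes> brH) \<oplus> z \<odot> (Idt 1 \<otimes> brA))
     \<in> brauer_relations v z \<delta>"
| "((brA \<otimes> Idt 1) \<cdot> (Idt 1 \<otimes> brH) \<cdot> (brH \<otimes> Idt 1), Idt 1 \<otimes> brA) \<in> brauer_relations v z \<delta>"
| "((brH \<otimes> Idt 1) \<cdot> (Idt 1 \<otimes> brH) \<cdot> (brH \<otimes> Idt 1), (Idt 1 \<otimes> brH) \<cdot> (brH \<otimes> Idt 1) \<cdot> (Idt 1 \<otimes> brH))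
     \<in> brauer_relations v z \<delta>"

definition brauer_presentation :: "'k::field \<Rightarrow> 'k \<Rightarrow> 'k \<Rightarrow> (brauer_gen, 'k) presentation" where
  "brauer_presentation v z \<delta> = \<lparr>
     gen_source = (\<lambda>g. case g of BrH \<Rightarrow> 2 | BrHinv \<Rightarrow> 2 | BrA \<Rightarrow> 2 | BrU \<Rightarrow> 0),
     gen_target = (\<lambda>g. case g of BrH \<Rightarrow> 2 | BrHinv \<Rightarrow> 2 | BrA \<Rightarrow> 0 | BrU \<Rightarrow> 2),
     relations = brauer_relations v z \<delta>\<rparr>"

definition brauer_category ::
    "'k::field \<Rightarrow> 'k \<Rightarrow> 'k \<Rightarrow> (nat, (brauer_gen, 'k) mterm set, 'k) lin_mon_cat" where
  "brauer_category v z \<delta> = presented_category (brauer_presentation v z \<delta>)"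


section \<open>The BWM-category\<close>

datatype bwm_gen = BwH | BwHbar | BwA | BwU

abbreviation "bwH \<equiv> Gen BwH"
abbreviation "bwHbar \<equiv> Gen BwHbar"
abbreviation "bwA \<equiv> Gen BwA"
abbreviation "bwU \<equiv> Gen BwU"

inductive_set bwm_relations ::
    "'k::field \<Rightarrow> 'k \<Rightarrow> 'k \<Rightarrow> ((bwm_gen, 'k) mterm \<times> (bwm_gen, 'k) mterm) set"
  for v z \<delta> :: "'k::field" where
  "(bwH \<oplus> (- 1) \<odot> bwHbar, z \<odot> Idt 2 \<oplus> (- z) \<odot> (bwU \<cdot> bwA)) \<in> bwm_relations v z \<delta>"
| "(bwA \<cdot> bwU, \<delta> \<odot> Idt 0) \<in> bwm_relations v z \<delta>"
| "(bwH \<cdot> bwU, v \<odot> bwU) \<in> bwm_relations v z \<delta>"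
| "(bwA \<cdot> bwH, v \<odot> bwA) \<in> bwm_relations v z \<delta>"
| "(bwH \<cdot> bwHbar, Idt 2) \<in> bwm_relations v z \<delta>"
| "(bwHbar \<cdot> bwH, Idt 2) \<in> bwm_relations v z \<delta>"
| "((bwH \<otimes> Idt 1) \<cdot> (Idt 1 \<otimes> bwH) \<cdot> (bwH \<otimes> Idt 1), (Idt 1 \<otimes> bwH) \<cdot> (bwH \<otimes> Idt 1) \<cdot> (Idt 1 \<otimes> bwH))
     \<in> bwm_relations v z \<delta>"
| "((bwA \<otimes> Idt 1) \<cdot> (Idt 1 \<otimes> bwU), Idt 1) \<in> bwm_relations v z \<delta>"
| "((Idt 1 \<otimes> bwA) \<cdot> (bwU \<otimes> Idt 1), Idt 1) \<in> bwm_relations v z \<delta>"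
| "((bwH \<otimes> Idt 1) \<cdot> (Idt 1 \<otimes> bwH) \<cdot> (bwU \<otimes> Idt 1), Idt 1 \<otimes> bwU) \<in> bwm_relations v z \<delta>"
| "((Idt 1 \<otimes> bwH) \<cdot> (bwH \<otimes> Idt 1) \<cdot> (Idt 1 \<otimes> bwU), bwU \<otimes> Idt 1) \<in> bwm_relations v z \<delta>"
| "((bwA \<otimes> Idt 1) \<cdot> (Idt 1 \<otimes> bwH) \<cdot> (bwU \<otimes> Idt 1), inverse v \<odot> Idt 1)
     \<in> bwm_relations v z \<delta>"
| "((Idt 1 \<otimes> bwA) \<cdot> (bwH \<otimes> Idt 1) \<cdot> (Idt 1 \<otimes> bwU), inverse v \<odot> Idt 1)
     \<in> bwm_relations v z \<delta>"

definition bwm_presentation :: "'k::field \<Rightarrow> 'k \<Rightarrow> 'k \<Rightarrow> (bwm_gen, 'k) presentation" where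
  "bwm_presentation v z \<delta> = \<lparr>
     gen_source = (\<lambda>g. case g of BwH \<Rightarrow> 2 | BwHbar \<Rightarrow> 2 | BwA \<Rightarrow> 2 | BwU \<Rightarrow> 0),
     gen_target = (\<lambda>g. case g of BwH \<Rightarrow> 2 | BwHbar \<Rightarrow> 2 | BwA \<Rightarrow> 0 | BwU \<Rightarrow> 2),
     relations = bwm_relations v z \<delta>\<rparr>"

definition bwm_category ::
    "'k::field \<Rightarrow> 'k \<Rightarrow> 'k \<Rightarrow> (nat, (bwm_gen, 'k) mterm set, 'k) lin_mon_cat" where
  "bwm_category v z \<delta> = presented_category (bwm_presentation v z \<delta>)"


section \<open>All relations relate parallel expressions\<close>

lemma brauer_relations_typed:
  "(f, g) \<in> relations (brauer_presentation v z \<delta>) \<Longrightarrow>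
     \<exists>m n. typed (brauer_presentation v z \<delta>) f m n \<and> typed (brauer_presentation v z \<delta>) g m n"
  unfolding brauer_presentation_def
  by (simp, erule brauer_relations.cases) (simp_all add: typed_iff)

lemma bwm_relations_typed:
  "(f, g) \<in> relations (bwm_presentation v z \<delta>) \<Longrightarrow>
     \<exists>m n. typed (bwm_presentation v z \<delta>) f m n \<and> typed (bwm_presentation v z \<delta>) g m n"
  unfolding bwm_presentation_def
  by (simp, erule bwm_relations.cases) (simp_all add: typed_iff)

end

theory Submission
  imports Defs
begin

text \<open>
  Sending $H \mapsto H$, $H^{-1} \mapsto \bar H$, $A \mapsto A$, $U \mapsto U$ gives mutually
  inverse functors once each family of relations is derived from the other.  Composing the skein
  relation with $H$ or $\bar H$ shows that it is equivalent to the quadratic relation for $H$.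
  Given the skein relation, substituting for $\bar H$ and straightening a zigzag turns
  $(I \otimes \bar H)(U \otimes I) = (H \otimes I)(I \otimes U)$, which is the second half of (6),
  into the three-term relation for the cup.  Rotating the two cup relations by bending strands gives
  the two cap relations.  The second curl relation follows from the three-term cup relation by
  closing with a cap, and this is where $v^{-1} - v = z(\delta - 1)$ enters.
\<close>

section \<open>Functors between presented categories\<close>

abbreviation rename :: "('g \<Rightarrow> 'h) \<Rightarrow> ('g, 'k) mterm \<Rightarrow> ('h, 'k) mterm" where
  "rename h \<equiv> map_mterm h (\<lambda>x. x)"

lemma typed_rename:
  assumes "typed P f m n"
    and "\<And>x. gen_source Q (h x) = gen_source P x" "\<And>x. gen_target Q (h x) = gen_target P x"
  shows "typed Q (rename h f) m n"
  using assms(1) by (induction rule: typed.induct) (auto intro: typed.intros simp: typed_iff assms(2,3))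

text \<open>The axioms of a linear monoidal category hold for every presentation, so only the case
  of the defining relations needs an assumption.\<close>

lemma mor_eq_rename:
  assumes "mor_eq P m n f g"
    and "\<And>x. gen_source Q (h x) = gen_source P x" "\<And>x. gen_target Q (h x) = gen_target P x"
    and "\<And>f g m n. (f, g) \<in> relations P \<Longrightarrow> typed P f m n \<Longrightarrow> typed P g m n \<Longrightarrow>
           mor_eq Q m n (rename h f) (rename h g)"
  shows "mor_eq Q m n (rename h f) (rename h g)"
  using assms(1)
proof (induction rule: mor_eq.induct)
  case mor_sym then show ?case by (blast intro: mor_eq.mor_sym)
next
  case mor_trans then show ?case by (blast intro: mor_eq.mor_trans)
qed (auto intro: mor_eq.intros(2,5-) typed_rename assms(2-4))

text \<open>The union over all representatives avoids choosing one; it collapses to a single class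
  as soon as renaming respects \<open>mor_eq\<close>.\<close>

definition map_class ::
    "('h, 'k::field, 'e) presentation_scheme \<Rightarrow> ('g \<Rightarrow> 'h) \<Rightarrow> ('g, 'k) mterm set \<Rightarrow> ('h, 'k) mterm set"
  where "map_class Q h X = (\<Union>f \<in> X. mor_class Q (rename h f))"

text \<open>Images of relations are compared as classes, so that each obligation becomes an equation
  between morphisms of the target category and can be settled by diagram calculus.\<close>

locale presentation_map =
  fixes P :: "('g, 'k::field, 'e) presentation_scheme" and Q :: "('h, 'k, 'e') presentation_scheme"
    and h :: "'g \<Rightarrow> 'h"
  assumes source: "gen_source Q (h x) = gen_source P x"
    and target: "gen_target Q (h x) = gen_target P x"
    and relation: "(f, g) \<in> relations P \<Longrightarrow> typed P f m n \<Longrightarrow> typed P g m n \<Longrightarrow>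
           mor_class Q (rename h f) = mor_class Q (rename h g)"
begin

lemma typed_map: "typed P f m n \<Longrightarrow> typed Q (rename h f) m n"
  by (rule typed_rename [OF _ source target])

lemma mor_eq_map: "mor_eq P m n f g \<Longrightarrow> mor_eq Q m n (rename h f) (rename h g)"
  by (rule mor_eq_rename [OF _ source target])
    (use relation typed_map mor_class_eq_iff in blast)+

lemma well_formed_rename [simp]:
  assumes "well_formed P f"
  shows "well_formed Q (rename h f)" "term_source Q (rename h f) = term_source P f"
    "term_target Q (rename h f) = term_target P f"
  using assms typed_map [of f "term_source P f" "term_target P f"] by (simp_all add: typed_iff)

lemma map_class_mor_class:
  assumes "well_formed P f"
  shows "map_class Q h (mor_class P f) = mor_class Q (rename h f)"
proof -
  have "mor_class Q (rename h f') = mor_class Q (rename h f)" if "f' \<in> mor_class P f" for f'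
    using that assms mor_eq_map [THEN mor_class_eqI] by (metis mem_mor_class typed_iff)
  moreover have "f \<in> mor_class P f"
    using assms mem_mor_class mor_eq.mor_refl typed_iff by blast
  ultimately show ?thesis
    unfolding map_class_def by blast
qed

text \<open>Renaming commutes with every term constructor, so each functor law can be checked on
  representatives.\<close>

lemma map_functor:
  "strict_linear_monoidal_functor (presented_category P) (presented_category Q) id (map_class Q h)"
proof -
  interpret source: strict_linear_monoidal_category "presented_category P"
    by (rule presented_category_is_category)
  interpret target: strict_linear_monoidal_category "presented_category Q"
    by (rule presented_category_is_category)
  show ?thesis
    by (unfold_locales; clarsimp simp: map_class_mor_class typed_iff presented_category_ops)
      (metis well_formed_rename)
qed

end

text \<open>Renaming is functorial, so inverse bijections of generators give inverse maps already on
  terms, hence on classes.\<close>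

lemma presentation_isomorphism:
  assumes "presentation_map P Q h" "presentation_map Q P k"
    and "\<And>x. k (h x) = x" "\<And>y. h (k y) = y"
  shows "strict_monoidal_isomorphic (presented_category P) (presented_category Q)"
proof -
  interpret hmap: presentation_map P Q h by fact
  interpret kmap: presentation_map Q P k by fact
  have [simp]: "rename k (rename h f) = f" "rename h (rename k g) = g" for f g
    using assms(3,4) by (simp_all add: mterm.map_comp comp_def mterm.map_ident)
  have "map_class P k (map_class Q h (mor_class P f)) = mor_class P f" if "typed P f m n" for f m n
    using that by (simp add: typed_iff hmap.map_class_mor_class kmap.map_class_mor_class)
  moreover have "map_class Q h (map_class P k (mor_class Q f)) = mor_class Q f"
    if "typed Q f m n" for f m n
    using that by (simp add: typed_iff hmap.map_class_mor_class kmap.map_class_mor_class)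
  ultimately show ?thesis
    unfolding strict_monoidal_isomorphic_def
    by (intro exI [of _ id] exI [of _ "map_class Q h"] exI [of _ "map_class P k"] conjI
        hmap.map_functor kmap.map_functor) auto
qed

section \<open>Diagram calculus\<close>

text \<open>Keeps \<open>1\<close> from becoming \<open>Suc 0\<close>, so that objects in side
  conditions and in relations share one numeral form.\<close>

declare One_nat_def [simp del]

locale numeric_category = strict_linear_monoidal_category C
  for C :: "(nat, 'm, 'k::field) lin_mon_cat" +
  assumes Obj [simp]: "Obj C = UNIV"
    and tensor_obj_plus [simp]: "tensor_obj C = (+)"
    and unit_obj_zero [simp]: "unit_obj C = 0"
begin

text \<open>
  Computable sources and targets turn the typing premises, whose objects do not occur in the
  conclusions of the axioms, into side conditions that the simplifier can discharge.
\<close>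

definition arr :: "'m \<Rightarrow> bool" where "arr f \<longleftrightarrow> (\<exists>m n. f \<in> Hom C m n)"
definition src :: "'m \<Rightarrow> nat" where "src f = (THE m. \<exists>n. f \<in> Hom C m n)"
definition tgt :: "'m \<Rightarrow> nat" where "tgt f = (THE n. \<exists>m. f \<in> Hom C m n)"

abbreviation I :: "nat \<Rightarrow> 'm" where "I \<equiv> ident C"
abbreviation comp_C (infixl \<open>\<circ>\<^sub>C\<close> 70) where "comp_C \<equiv> compose C"
abbreviation tens_C (infixl \<open>\<otimes>\<^sub>C\<close> 75) where "tens_C \<equiv> tensor C"
abbreviation add_C (infixl \<open>\<oplus>\<^sub>C\<close> 65) where "add_C \<equiv> hom_add C"
abbreviation scale_C (infixr \<open>\<odot>\<^sub>C\<close> 68) where "scale_C \<equiv> hom_scale C"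

lemma hom_src_tgt: "f \<in> Hom C m n \<Longrightarrow> arr f \<and> src f = m \<and> tgt f = n"
proof -
  assume f: "f \<in> Hom C m n"
  then have "m' = m \<and> n' = n" if "f \<in> Hom C m' n'" for m' n'
    using hom_disjoint [OF _ _ _ _ that f] by simp
  with f have "(THE m. \<exists>n. f \<in> Hom C m n) = m" "(THE n. \<exists>m. f \<in> Hom C m n) = n"
    by (intro the_equality; blast)+
  with f show ?thesis
    unfolding arr_def src_def tgt_def by blast
qed

lemma hom_iff: "f \<in> Hom C m n \<longleftrightarrow> arr f \<and> src f = m \<and> tgt f = n"
  using hom_src_tgt unfolding arr_def by blast

section \<open>Typing rules and the axioms in terms of \<open>src\<close> and
  \<open>tgt\<close>\<close>

lemma arr_ident [simp]: "arr (I n)" "src (I n) = n" "tgt (I n) = n"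
  using hom_src_tgt [OF ident] by simp_all

lemma arr_comp [simp]:
  assumes "arr f" "arr g" "tgt f = src g"
  shows "arr (g \<circ>\<^sub>C f)" "src (g \<circ>\<^sub>C f) = src f" "tgt (g \<circ>\<^sub>C f) = tgt g"
  using assms hom_src_tgt [OF compose, of "src f" "tgt f" "tgt g" f g] by (auto simp: hom_iff)

lemma arr_tens [simp]:
  assumes "arr f" "arr g"
  shows "arr (f \<otimes>\<^sub>C g)" "src (f \<otimes>\<^sub>C g) = src f + src g" "tgt (f \<otimes>\<^sub>C g) = tgt f + tgt g"
  using assms hom_src_tgt [OF tensor, of "src f" "tgt f" "src g" "tgt g" f g]
  by (auto simp: hom_iff)

lemma arr_add [simp]:
  assumes "arr f" "arr g" "src f = src g" "tgt f = tgt g"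
  shows "arr (f \<oplus>\<^sub>C g)" "src (f \<oplus>\<^sub>C g) = src g" "tgt (f \<oplus>\<^sub>C g) = tgt g"
  using assms hom_src_tgt [OF hom_add, of "src f" "tgt f" f g] by (auto simp: hom_iff)

lemma arr_scale [simp]:
  assumes "arr f"
  shows "arr (x \<odot>\<^sub>C f)" "src (x \<odot>\<^sub>C f) = src f" "tgt (x \<odot>\<^sub>C f) = tgt f"
  using assms hom_src_tgt [OF hom_scale, of "src f" "tgt f" f x] by (auto simp: hom_iff)

lemma comp_ident [simp]:
  "arr f \<Longrightarrow> tgt f = n \<Longrightarrow> I n \<circ>\<^sub>C f = f" "arr f \<Longrightarrow> src f = n \<Longrightarrow> f \<circ>\<^sub>C I n = f"
  using compose_ident by (auto simp: hom_iff)

lemma comp_assoc: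
  "arr f \<Longrightarrow> arr g \<Longrightarrow> arr h \<Longrightarrow> tgt f = src g \<Longrightarrow> tgt g = src h \<Longrightarrow>
     h \<circ>\<^sub>C g \<circ>\<^sub>C f = h \<circ>\<^sub>C (g \<circ>\<^sub>C f)"
  using compose_assoc by (auto simp: hom_iff)

lemma tens_comp:
  "arr f \<Longrightarrow> arr g \<Longrightarrow> arr f' \<Longrightarrow> arr g' \<Longrightarrow> tgt f = src g \<Longrightarrow> tgt f' = src g' \<Longrightarrow>
     (g \<otimes>\<^sub>C g') \<circ>\<^sub>C (f \<otimes>\<^sub>C f') = (g \<circ>\<^sub>C f) \<otimes>\<^sub>C (g' \<circ>\<^sub>C f')"
  using interchange by (auto simp: hom_iff)

lemma tens_assoc: "arr f \<Longrightarrow> arr g \<Longrightarrow> arr h \<Longrightarrow> f \<otimes>\<^sub>C g \<otimes>\<^sub>C h = f \<otimes>\<^sub>C (g \<otimes>\<^sub>C h)"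
  using tensor_assoc by (auto simp: hom_iff)

lemma tens_ident [simp]: "I m \<otimes>\<^sub>C I n = I (m + n)"
  using tensor_ident by simp

lemma tens_unit [simp]: "arr f \<Longrightarrow> I 0 \<otimes>\<^sub>C f = f" "arr f \<Longrightarrow> f \<otimes>\<^sub>C I 0 = f"
  using tensor_unit by (auto simp: hom_iff)

lemma add_assoc:
  "arr f \<Longrightarrow> arr g \<Longrightarrow> arr h \<Longrightarrow> src f = src g \<Longrightarrow> src g = src h \<Longrightarrow> tgt f = tgt g \<Longrightarrow>
     tgt g = tgt h \<Longrightarrow> f \<oplus>\<^sub>C g \<oplus>\<^sub>C h = f \<oplus>\<^sub>C (g \<oplus>\<^sub>C h)"
  using hom_add_assoc by (auto simp: hom_iff)

lemma add_commute:
  "arr f \<Longrightarrow> arr g \<Longrightarrow> src f = src g \<Longrightarrow> tgt f = tgt g \<Longrightarrow> f \<oplus>\<^sub>C g = g \<oplus>\<^sub>C f"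
  using hom_add_commute by (auto simp: hom_iff)

lemma add_left_commute:
  "arr f \<Longrightarrow> arr g \<Longrightarrow> arr h \<Longrightarrow> src f = src g \<Longrightarrow> src g = src h \<Longrightarrow> tgt f = tgt g \<Longrightarrow>
     tgt g = tgt h \<Longrightarrow> f \<oplus>\<^sub>C (g \<oplus>\<^sub>C h) = g \<oplus>\<^sub>C (f \<oplus>\<^sub>C h)"
  by (metis add_assoc add_commute)

lemma scale_add [simp]:
  "arr f \<Longrightarrow> arr g \<Longrightarrow> src f = src g \<Longrightarrow> tgt f = tgt g \<Longrightarrow>
     x \<odot>\<^sub>C (f \<oplus>\<^sub>C g) = x \<odot>\<^sub>C f \<oplus>\<^sub>C x \<odot>\<^sub>C g"
  using hom_scale_add by (auto simp: hom_iff)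

lemma add_scale: "arr f \<Longrightarrow> (x + y) \<odot>\<^sub>C f = x \<odot>\<^sub>C f \<oplus>\<^sub>C y \<odot>\<^sub>C f"
  using hom_scale_add by (auto simp: hom_iff)

lemma scale_scale [simp]: "arr f \<Longrightarrow> x \<odot>\<^sub>C y \<odot>\<^sub>C f = (x * y) \<odot>\<^sub>C f"
  using hom_scale_scale by (auto simp: hom_iff)

lemma scale_one [simp]: "arr f \<Longrightarrow> 1 \<odot>\<^sub>C f = f"
  using hom_scale_one by (auto simp: hom_iff)

lemma comp_add [simp]:
  "arr f \<Longrightarrow> arr f' \<Longrightarrow> arr g \<Longrightarrow> src f = src f' \<Longrightarrow> tgt f = tgt f' \<Longrightarrow> tgt f' = src g \<Longrightarrow>
     g \<circ>\<^sub>C (f \<oplus>\<^sub>C f') = g \<circ>\<^sub>C f \<oplus>\<^sub>C g \<circ>\<^sub>C f'"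
  "arr f \<Longrightarrow> arr g \<Longrightarrow> arr g' \<Longrightarrow> src g = src g' \<Longrightarrow> tgt g = tgt g' \<Longrightarrow> tgt f = src g' \<Longrightarrow>
     (g \<oplus>\<^sub>C g') \<circ>\<^sub>C f = g \<circ>\<^sub>C f \<oplus>\<^sub>C g' \<circ>\<^sub>C f"
  using compose_add by (auto simp: hom_iff)

lemma comp_scale [simp]:
  "arr f \<Longrightarrow> arr g \<Longrightarrow> tgt f = src g \<Longrightarrow> g \<circ>\<^sub>C (x \<odot>\<^sub>C f) = x \<odot>\<^sub>C (g \<circ>\<^sub>C f)"
  "arr f \<Longrightarrow> arr g \<Longrightarrow> tgt f = src g \<Longrightarrow> (x \<odot>\<^sub>C g) \<circ>\<^sub>C f = x \<odot>\<^sub>C (g \<circ>\<^sub>C f)"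
  using compose_scale by (auto simp: hom_iff)

lemma tens_add [simp]:
  "arr f \<Longrightarrow> arr g \<Longrightarrow> arr g' \<Longrightarrow> src g = src g' \<Longrightarrow> tgt g = tgt g' \<Longrightarrow>
     f \<otimes>\<^sub>C (g \<oplus>\<^sub>C g') = f \<otimes>\<^sub>C g \<oplus>\<^sub>C f \<otimes>\<^sub>C g'"
  "arr f \<Longrightarrow> arr f' \<Longrightarrow> arr g \<Longrightarrow> src f = src f' \<Longrightarrow> tgt f = tgt f' \<Longrightarrow>
     (f \<oplus>\<^sub>C f') \<otimes>\<^sub>C g = f \<otimes>\<^sub>C g \<oplus>\<^sub>C f' \<otimes>\<^sub>C g"
  using tensor_add by (auto simp: hom_iff)

lemma tens_scale [simp]:
  "arr f \<Longrightarrow> arr g \<Longrightarrow> f \<otimes>\<^sub>C (x \<odot>\<^sub>C g) = x \<odot>\<^sub>C (f \<otimes>\<^sub>C g)"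
  "arr f \<Longrightarrow> arr g \<Longrightarrow> (x \<odot>\<^sub>C f) \<otimes>\<^sub>C g = x \<odot>\<^sub>C (f \<otimes>\<^sub>C g)"
  using tensor_scale by (auto simp: hom_iff)

section \<open>Cancellation and subtraction in Hom-spaces\<close>

lemma add_cancel:
  assumes "f \<oplus>\<^sub>C h = g \<oplus>\<^sub>C h" "f \<in> Hom C m n" "g \<in> Hom C m n" "h \<in> Hom C m n"
  shows "f = g"
proof -
  obtain h' where h': "h' \<in> Hom C m n" "h \<oplus>\<^sub>C h' = hom_zero C m n"
    using hom_add_inverse [of m n h] assms(4) by auto
  then have "e \<oplus>\<^sub>C h \<oplus>\<^sub>C h' = e" if "e \<in> Hom C m n" for e
    using that assms(4) by (simp add: hom_add_assoc [of m n] hom_add_zero)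
  then show ?thesis
    using assms(1-3) by metis
qed

text \<open>The axioms only assert that some additive inverse exists; with distributivity, this
  vanishing shows that the multiple by \<open>- 1\<close> is one.\<close>

lemma scale_zero: assumes "f \<in> Hom C m n" shows "0 \<odot>\<^sub>C f = hom_zero C m n"
proof -
  have "0 \<odot>\<^sub>C f \<oplus>\<^sub>C 0 \<odot>\<^sub>C f = hom_zero C m n \<oplus>\<^sub>C 0 \<odot>\<^sub>C f"
    using assms add_scale [of f 0 0] hom_add_zero [of m n "0 \<odot>\<^sub>C f"]
      hom_add_commute [of m n "0 \<odot>\<^sub>C f" "hom_zero C m n"] hom_zero [of m n]
    by (auto simp: hom_iff)
  then show ?thesis
    by (rule add_cancel [of _ "0 \<odot>\<^sub>C f" _ m n])
      (use assms hom_scale hom_zero in auto)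
qed

text \<open>Subtraction is encoded as adding a multiple by \<open>- 1\<close>, so solving the skein
  relation for one crossing needs this transfer rule.\<close>

lemma eq_add_minus_iff:
  assumes "f \<in> Hom C m n" "g \<in> Hom C m n" "h \<in> Hom C m n"
  shows "f \<oplus>\<^sub>C (- 1) \<odot>\<^sub>C g = h \<longleftrightarrow> f = h \<oplus>\<^sub>C g"
proof -
  have z: "(- 1) \<odot>\<^sub>C g \<oplus>\<^sub>C g = hom_zero C m n"
    using assms add_scale [of g "- 1" 1] by (simp add: scale_zero hom_iff)
  have "f \<oplus>\<^sub>C (- 1) \<odot>\<^sub>C g \<oplus>\<^sub>C g = f"
    using assms z hom_add_assoc [of m n f "(- 1) \<odot>\<^sub>C g" g] hom_add_zero [of m n f]
    by (simp add: hom_scale)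
  then show ?thesis
    using add_cancel [of "f \<oplus>\<^sub>C (- 1) \<odot>\<^sub>C g" g h m n] assms
    by (auto simp: hom_add hom_scale)
qed

section \<open>Sliding past each other and whiskering by identity strands\<close>

lemma interchange_slide:
  assumes "arr f" "arr g"
  shows "(f \<otimes>\<^sub>C I (tgt g)) \<circ>\<^sub>C (I (src f) \<otimes>\<^sub>C g) = (I (tgt f) \<otimes>\<^sub>C g) \<circ>\<^sub>C (f \<otimes>\<^sub>C I (src g))"
  using assms by (simp add: tens_comp)

lemma whisker_left: "arr f \<Longrightarrow> arr g \<Longrightarrow> tgt f = src g \<Longrightarrow>
    I k \<otimes>\<^sub>C (g \<circ>\<^sub>C f) = (I k \<otimes>\<^sub>C g) \<circ>\<^sub>C (I k \<otimes>\<^sub>C f)"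
  by (simp add: tens_comp)

lemma whisker_right: "arr f \<Longrightarrow> arr g \<Longrightarrow> tgt f = src g \<Longrightarrow>
    (g \<circ>\<^sub>C f) \<otimes>\<^sub>C I k = (g \<otimes>\<^sub>C I k) \<circ>\<^sub>C (f \<otimes>\<^sub>C I k)"
  by (simp add: tens_comp)

lemma whisker_whisker:
  assumes "arr f"
  shows "I k \<otimes>\<^sub>C (I l \<otimes>\<^sub>C f) = I (k + l) \<otimes>\<^sub>C f" "f \<otimes>\<^sub>C I k \<otimes>\<^sub>C I l = f \<otimes>\<^sub>C I (k + l)"
  using assms tens_assoc [of "I k" "I l" f] tens_assoc [of f "I k" "I l"] by simp_all

end

section \<open>Bending and rotating morphisms with cups and caps\<close>

locale zigzag_category = numeric_category C
  for C :: "(nat, 'm, 'k::field) lin_mon_cat" +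
  fixes A U :: 'm
  assumes A [simp]: "arr A" "src A = 2" "tgt A = 0"
    and U [simp]: "arr U" "src U = 0" "tgt U = 2"
    and zigzag: "(A \<otimes>\<^sub>C I 1) \<circ>\<^sub>C (I 1 \<otimes>\<^sub>C U) = I 1" "(I 1 \<otimes>\<^sub>C A) \<circ>\<^sub>C (U \<otimes>\<^sub>C I 1) = I 1"
begin

text \<open>\<open>A\<close> slides past \<open>W\<close> and is then straightened against \<open>U\<close>.\<close>

lemma bend_left:
  assumes W: "arr W" "src W = 1 + k"
  shows "(A \<otimes>\<^sub>C I (tgt W)) \<circ>\<^sub>C (I 1 \<otimes>\<^sub>C ((I 1 \<otimes>\<^sub>C W) \<circ>\<^sub>C (U \<otimes>\<^sub>C I k))) = W"
proof -
  have "(A \<otimes>\<^sub>C I (tgt W)) \<circ>\<^sub>C (I 1 \<otimes>\<^sub>C ((I 1 \<otimes>\<^sub>C W) \<circ>\<^sub>C (U \<otimes>\<^sub>C I k)))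
      = ((A \<otimes>\<^sub>C I (tgt W)) \<circ>\<^sub>C (I 2 \<otimes>\<^sub>C W)) \<circ>\<^sub>C (I 1 \<otimes>\<^sub>C U \<otimes>\<^sub>C I k)"
    using W by (simp add: whisker_left whisker_whisker comp_assoc tens_assoc)
  also have "\<dots> = W \<circ>\<^sub>C ((A \<otimes>\<^sub>C I (1 + k)) \<circ>\<^sub>C (I 1 \<otimes>\<^sub>C U \<otimes>\<^sub>C I k))"
    using W interchange_slide [of A W] by (simp add: comp_assoc)
  also have "(A \<otimes>\<^sub>C I (1 + k)) \<circ>\<^sub>C (I 1 \<otimes>\<^sub>C U \<otimes>\<^sub>C I k)
      = ((A \<otimes>\<^sub>C I 1) \<circ>\<^sub>C (I 1 \<otimes>\<^sub>C U)) \<otimes>\<^sub>C I k"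
    by (simp add: whisker_right whisker_whisker)
  finally show ?thesis
    using W by (simp add: zigzag)
qed

text \<open>\<open>rot\<close> turns \<open>X\<close> bent along the cup into \<open>Y\<close>; then
  \<open>Y\<close> slides past the cap on the last two strands, and the remaining cup and cap
  straighten.\<close>

lemma bend_right:
  assumes X: "arr X" "src X = 2" "tgt X = 2"
    and Y: "arr Y" "src Y = 2" "tgt Y = 2"
    and rot: "(I 1 \<otimes>\<^sub>C X) \<circ>\<^sub>C (U \<otimes>\<^sub>C I 1) = (Y \<otimes>\<^sub>C I 1) \<circ>\<^sub>C (I 1 \<otimes>\<^sub>C U)"
  shows "(I 1 \<otimes>\<^sub>C ((I 1 \<otimes>\<^sub>C A) \<circ>\<^sub>C (X \<otimes>\<^sub>C I 1))) \<circ>\<^sub>C (U \<otimes>\<^sub>C I 2) = Y"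
proof -
  have slide: "(I 2 \<otimes>\<^sub>C A) \<circ>\<^sub>C (Y \<otimes>\<^sub>C I 2) = Y \<circ>\<^sub>C (I 2 \<otimes>\<^sub>C A)"
    using Y interchange_slide [of Y A] by simp
  have "(I 1 \<otimes>\<^sub>C ((I 1 \<otimes>\<^sub>C A) \<circ>\<^sub>C (X \<otimes>\<^sub>C I 1))) \<circ>\<^sub>C (U \<otimes>\<^sub>C I 2)
      = (I 2 \<otimes>\<^sub>C A) \<circ>\<^sub>C (((I 1 \<otimes>\<^sub>C X) \<circ>\<^sub>C (U \<otimes>\<^sub>C I 1)) \<otimes>\<^sub>C I 1)"
    using X by (simp add: whisker_left whisker_right whisker_whisker comp_assoc tens_assoc)
  also have "\<dots> = ((I 2 \<otimes>\<^sub>C A) \<circ>\<^sub>C (Y \<otimes>\<^sub>C I 2)) \<circ>\<^sub>C (I 1 \<otimes>\<^sub>C (U \<otimes>\<^sub>C I 1))"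
    unfolding rot
    using Y by (simp add: whisker_left whisker_right whisker_whisker comp_assoc tens_assoc)
  also have "\<dots> = Y \<circ>\<^sub>C (I 1 \<otimes>\<^sub>C ((I 1 \<otimes>\<^sub>C A) \<circ>\<^sub>C (U \<otimes>\<^sub>C I 1)))"
    unfolding slide using Y by (simp add: whisker_left whisker_whisker comp_assoc)
  finally show ?thesis
    using Y by (simp add: zigzag)
qed

text \<open>Bending can be undone: \<open>bend_left\<close> recovers the cap composed with
  \<open>X\<close> from its bent form, which is \<open>Y\<close> by \<open>bend_right\<close>. This
  converts cup relations into cap relations.\<close>

lemma rotate:
  assumes X: "arr X" "src X = 2" "tgt X = 2"
    and Y: "arr Y" "src Y = 2" "tgt Y = 2"
    and rot: "(I 1 \<otimes>\<^sub>C X) \<circ>\<^sub>C (U \<otimes>\<^sub>C I 1) = (Y \<otimes>\<^sub>C I 1) \<circ>\<^sub>C (I 1 \<otimes>\<^sub>C U)"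
  shows "(A \<otimes>\<^sub>C I 1) \<circ>\<^sub>C (I 1 \<otimes>\<^sub>C Y) = (I 1 \<otimes>\<^sub>C A) \<circ>\<^sub>C (X \<otimes>\<^sub>C I 1)"
  \<comment> \<open>The morphism has three input strands: one is bent, and the other two give the
    parameter \<open>2\<close>.\<close>
  using bend_left [of "(I 1 \<otimes>\<^sub>C A) \<circ>\<^sub>C (X \<otimes>\<^sub>C I 1)" 2] bend_right [OF X Y rot] X
  by simp

end

section \<open>Crossings\<close>

text \<open>\<open>K\<close> is the formal inverse of \<open>H\<close> in one category and the
  under-cross in the other. Apart from typing and \<open>v \<noteq> 0\<close>, the assumptions are
  relations listed in both presentations, so the lemmas apply to either.\<close>

locale crossing_category = zigzag_category C A U
  for C :: "(nat, 'm, 'k::field) lin_mon_cat" and A U :: 'm +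
  fixes H K :: 'm and v z :: 'k
  assumes H [simp]: "arr H" "src H = 2" "tgt H = 2"
    and K [simp]: "arr K" "src K = 2" "tgt K = 2"
    and v: "v \<noteq> 0"
    and inverse: "H \<circ>\<^sub>C K = I 2" "K \<circ>\<^sub>C H = I 2"
    and twist: "H \<circ>\<^sub>C U = v \<odot>\<^sub>C U"
begin

section \<open>The skein relation and its quadratic form\<close>

abbreviation skein :: bool where
  "skein \<equiv> H \<oplus>\<^sub>C (- 1) \<odot>\<^sub>C K = z \<odot>\<^sub>C I 2 \<oplus>\<^sub>C (- z) \<odot>\<^sub>C (U \<circ>\<^sub>C A)"

lemma skein_iff_H: "skein \<longleftrightarrow> H = K \<oplus>\<^sub>C z \<odot>\<^sub>C I 2 \<oplus>\<^sub>C (- z) \<odot>\<^sub>C (U \<circ>\<^sub>C A)"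
  by (subst eq_add_minus_iff [of _ 2 2])
    (simp_all add: hom_iff add_assoc add_commute add_left_commute)

lemma skein_iff_K: "skein \<longleftrightarrow> K = (- z) \<odot>\<^sub>C I 2 \<oplus>\<^sub>C H \<oplus>\<^sub>C z \<odot>\<^sub>C (U \<circ>\<^sub>C A)"
proof -
  let ?E = "z \<odot>\<^sub>C I 2 \<oplus>\<^sub>C (- z) \<odot>\<^sub>C (U \<circ>\<^sub>C A)"
  have "skein \<longleftrightarrow> H = K \<oplus>\<^sub>C ?E"
    by (simp add: skein_iff_H add_assoc)
  \<comment> \<open>The transfer rule read backwards isolates \<open>K\<close>.\<close>
  also have "\<dots> \<longleftrightarrow> H \<oplus>\<^sub>C (- 1) \<odot>\<^sub>C ?E = K"
    by (rule eq_add_minus_iff [of _ 2 2, symmetric]) (simp_all add: hom_iff)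
  also have "H \<oplus>\<^sub>C (- 1) \<odot>\<^sub>C ?E = (- z) \<odot>\<^sub>C I 2 \<oplus>\<^sub>C H \<oplus>\<^sub>C z \<odot>\<^sub>C (U \<circ>\<^sub>C A)"
    by (simp add: add_assoc add_commute add_left_commute)
  finally show ?thesis by metis
qed

text \<open>Apply \<open>K\<close> to \<open>twist\<close> and divide by \<open>v\<close>.\<close>

lemma twist_inverse: "K \<circ>\<^sub>C U = inverse v \<odot>\<^sub>C U"
proof -
  have "inverse v \<odot>\<^sub>C (K \<circ>\<^sub>C (H \<circ>\<^sub>C U)) = K \<circ>\<^sub>C U"
    using v by (simp add: twist)
  then show ?thesis
    by (simp add: inverse flip: comp_assoc)
qed

text \<open>Multiplying the form solved for \<open>H\<close> on the left by \<open>H\<close> uses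
  \<open>inverse\<close> and \<open>twist\<close>; the latter produces the factor \<open>v\<close>
  in the last coefficient. Multiplying by \<open>K\<close> goes back, since
  \<open>twist_inverse\<close> cancels that factor.\<close>

lemma skein_iff_quadratic:
  "skein \<longleftrightarrow> H \<circ>\<^sub>C H = I 2 \<oplus>\<^sub>C z \<odot>\<^sub>C H \<oplus>\<^sub>C (- (z * v)) \<odot>\<^sub>C (U \<circ>\<^sub>C A)"
    (is "_ \<longleftrightarrow> _ = ?R")
proof
  assume skein
  then have "H \<circ>\<^sub>C H = H \<circ>\<^sub>C (K \<oplus>\<^sub>C z \<odot>\<^sub>C I 2 \<oplus>\<^sub>C (- z) \<odot>\<^sub>C (U \<circ>\<^sub>C A))"
    unfolding skein_iff_H by metis
  also have "\<dots> = ?R"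
    by (simp add: inverse twist flip: comp_assoc)
  finally show "H \<circ>\<^sub>C H = ?R" .
next
  assume "H \<circ>\<^sub>C H = ?R"
  then have "K \<circ>\<^sub>C (H \<circ>\<^sub>C H) = K \<circ>\<^sub>C ?R"
    by simp
  then show skein
    unfolding skein_iff_H using v by (simp add: inverse twist_inverse mult.assoc flip: comp_assoc)
qed

text \<open>Expanding \<open>K\<close> by the skein relation yields exactly the right side of the
  three-term cup relation.\<close>

lemma cup_slide:
  assumes skein
  shows "(I 1 \<otimes>\<^sub>C K) \<circ>\<^sub>C (U \<otimes>\<^sub>C I 1)
    = (- z) \<odot>\<^sub>C (U \<otimes>\<^sub>C I 1) \<oplus>\<^sub>C (I 1 \<otimes>\<^sub>C H) \<circ>\<^sub>C (U \<otimes>\<^sub>C I 1) \<oplus>\<^sub>C z \<odot>\<^sub>C (I 1 \<otimes>\<^sub>C U)"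
proof -
  \<comment> \<open>The cap of the expansion meets the given cup in a zigzag, which leaves only the
    cup of the expansion.\<close>
  have "(I 1 \<otimes>\<^sub>C (U \<circ>\<^sub>C A)) \<circ>\<^sub>C (U \<otimes>\<^sub>C I 1) = I 1 \<otimes>\<^sub>C U"
    using zigzag by (simp add: whisker_left comp_assoc)
  then show ?thesis
    using assms unfolding skein_iff_K by simp
qed

lemma cap_slide:
  assumes skein
  shows "(A \<otimes>\<^sub>C I 1) \<circ>\<^sub>C (I 1 \<otimes>\<^sub>C K)
    = (- z) \<odot>\<^sub>C (A \<otimes>\<^sub>C I 1) \<oplus>\<^sub>C (A \<otimes>\<^sub>C I 1) \<circ>\<^sub>C (I 1 \<otimes>\<^sub>C H) \<oplus>\<^sub>C z \<odot>\<^sub>C (I 1 \<otimes>\<^sub>C A)"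
proof -
  \<comment> \<open>Here the given cap meets the cup of the expansion, so the other zigzag
    applies.\<close>
  have "(A \<otimes>\<^sub>C I 1) \<circ>\<^sub>C (I 1 \<otimes>\<^sub>C (U \<circ>\<^sub>C A)) = I 1 \<otimes>\<^sub>C A"
    using zigzag by (simp add: whisker_left flip: comp_assoc)
  then show ?thesis
    using assms unfolding skein_iff_K by simp
qed

section \<open>Pulling strands through cups and caps\<close>

lemma whiskered_inverse:
  "(H \<otimes>\<^sub>C I k) \<circ>\<^sub>C (K \<otimes>\<^sub>C I k) = I (2 + k)" "(K \<otimes>\<^sub>C I k) \<circ>\<^sub>C (H \<otimes>\<^sub>C I k) = I (2 + k)"
  "(I k \<otimes>\<^sub>C H) \<circ>\<^sub>C (I k \<otimes>\<^sub>C K) = I (k + 2)" "(I k \<otimes>\<^sub>C K) \<circ>\<^sub>C (I k \<otimes>\<^sub>C H) = I (k + 2)"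
  by (simp_all add: tens_comp inverse)

text \<open>Cancelling a whiskered crossing gives the form demanded by \<open>rotate\<close>, with
  \<open>H\<close> for \<open>X\<close> and \<open>K\<close> for \<open>Y\<close>.\<close>

lemma pull_cup_left_iff:
  "(H \<otimes>\<^sub>C I 1) \<circ>\<^sub>C (I 1 \<otimes>\<^sub>C H) \<circ>\<^sub>C (U \<otimes>\<^sub>C I 1) = I 1 \<otimes>\<^sub>C U \<longleftrightarrow>
     (I 1 \<otimes>\<^sub>C H) \<circ>\<^sub>C (U \<otimes>\<^sub>C I 1) = (K \<otimes>\<^sub>C I 1) \<circ>\<^sub>C (I 1 \<otimes>\<^sub>C U)" (is "?l = ?r \<longleftrightarrow> ?l' = ?r'")
proof
  assume "?l = ?r"
  then have "(K \<otimes>\<^sub>C I 1) \<circ>\<^sub>C ?l = ?r'" by simp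
  then show "?l' = ?r'"
    by (simp add: whiskered_inverse flip: comp_assoc)
next
  assume "?l' = ?r'"
  then have "(H \<otimes>\<^sub>C I 1) \<circ>\<^sub>C ?l' = (H \<otimes>\<^sub>C I 1) \<circ>\<^sub>C ?r'" by simp
  then show "?l = ?r"
    by (simp add: whiskered_inverse flip: comp_assoc)
qed

text \<open>Now \<open>rotate\<close> applies with \<open>K\<close> for \<open>X\<close> and
  \<open>H\<close> for \<open>Y\<close>. The left side of the second equation is also that of
  \<open>cup_slide\<close>, which links this relation to the three-term one.\<close>

lemma pull_cup_right_iff:
  "(I 1 \<otimes>\<^sub>C H) \<circ>\<^sub>C (H \<otimes>\<^sub>C I 1) \<circ>\<^sub>C (I 1 \<otimes>\<^sub>C U) = U \<otimes>\<^sub>C I 1 \<longleftrightarrow>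
     (I 1 \<otimes>\<^sub>C K) \<circ>\<^sub>C (U \<otimes>\<^sub>C I 1) = (H \<otimes>\<^sub>C I 1) \<circ>\<^sub>C (I 1 \<otimes>\<^sub>C U)" (is "?l = ?r \<longleftrightarrow> ?l' = ?r'")
proof
  assume "?l = ?r"
  then have "(I 1 \<otimes>\<^sub>C K) \<circ>\<^sub>C ?l = ?l'" by simp
  then show "?l' = ?r'"
    by (simp add: whiskered_inverse flip: comp_assoc)
next
  assume "?l' = ?r'"
  then have "(I 1 \<otimes>\<^sub>C H) \<circ>\<^sub>C ?l' = (I 1 \<otimes>\<^sub>C H) \<circ>\<^sub>C ?r'" by simp
  then show "?l = ?r"
    by (simp add: whiskered_inverse flip: comp_assoc)
qed

text \<open>Each cup relation turns under \<open>rotate\<close> into a cap relation: the first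
  directly, the second up to cancelling \<open>K\<close> against \<open>H\<close>.\<close>

lemma pull_cap:
  assumes "(H \<otimes>\<^sub>C I 1) \<circ>\<^sub>C (I 1 \<otimes>\<^sub>C H) \<circ>\<^sub>C (U \<otimes>\<^sub>C I 1) = I 1 \<otimes>\<^sub>C U"
    and "(I 1 \<otimes>\<^sub>C H) \<circ>\<^sub>C (H \<otimes>\<^sub>C I 1) \<circ>\<^sub>C (I 1 \<otimes>\<^sub>C U) = U \<otimes>\<^sub>C I 1"
  shows "(A \<otimes>\<^sub>C I 1) \<circ>\<^sub>C (I 1 \<otimes>\<^sub>C K) = (I 1 \<otimes>\<^sub>C A) \<circ>\<^sub>C (H \<otimes>\<^sub>C I 1)"
    and "(A \<otimes>\<^sub>C I 1) \<circ>\<^sub>C (I 1 \<otimes>\<^sub>C H) \<circ>\<^sub>C (H \<otimes>\<^sub>C I 1) = I 1 \<otimes>\<^sub>C A"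
proof -
  show "(A \<otimes>\<^sub>C I 1) \<circ>\<^sub>C (I 1 \<otimes>\<^sub>C K) = (I 1 \<otimes>\<^sub>C A) \<circ>\<^sub>C (H \<otimes>\<^sub>C I 1)"
    using assms(1) by (intro rotate) (simp_all only: pull_cup_left_iff H K)
  have "(A \<otimes>\<^sub>C I 1) \<circ>\<^sub>C (I 1 \<otimes>\<^sub>C H) = (I 1 \<otimes>\<^sub>C A) \<circ>\<^sub>C (K \<otimes>\<^sub>C I 1)"
    using assms(2) by (intro rotate) (simp_all only: pull_cup_right_iff H K)
  then show "(A \<otimes>\<^sub>C I 1) \<circ>\<^sub>C (I 1 \<otimes>\<^sub>C H) \<circ>\<^sub>C (H \<otimes>\<^sub>C I 1) = I 1 \<otimes>\<^sub>C A"
    by (simp add: comp_assoc whiskered_inverse)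
qed

text \<open>Close the three-term cup relation with a cap on the last two strands: the summands give
  \<open>- z\<close> by a zigzag, \<open>v\<close> by \<open>cap\<close> and a zigzag, and
  \<open>z * \<delta>\<close> by \<open>loop\<close>.\<close>

lemma curl:
  assumes skein
    and "(I 1 \<otimes>\<^sub>C K) \<circ>\<^sub>C (U \<otimes>\<^sub>C I 1) = (H \<otimes>\<^sub>C I 1) \<circ>\<^sub>C (I 1 \<otimes>\<^sub>C U)"
    and cap: "A \<circ>\<^sub>C H = v \<odot>\<^sub>C A"
    and loop: "A \<circ>\<^sub>C U = \<delta> \<odot>\<^sub>C I 0"
    and "inverse v - v = z * (\<delta> - 1)"
  shows "(I 1 \<otimes>\<^sub>C A) \<circ>\<^sub>C (H \<otimes>\<^sub>C I 1) \<circ>\<^sub>C (I 1 \<otimes>\<^sub>C U) = inverse v \<odot>\<^sub>C I 1"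
proof -
  have "(I 1 \<otimes>\<^sub>C A) \<circ>\<^sub>C (I 1 \<otimes>\<^sub>C H) = v \<odot>\<^sub>C (I 1 \<otimes>\<^sub>C A)" "(I 1 \<otimes>\<^sub>C A) \<circ>\<^sub>C (I 1 \<otimes>\<^sub>C U) = \<delta> \<odot>\<^sub>C I 1"
    by (simp_all add: cap loop flip: whisker_left)
  moreover have "(I 1 \<otimes>\<^sub>C A) \<circ>\<^sub>C (H \<otimes>\<^sub>C I 1) \<circ>\<^sub>C (I 1 \<otimes>\<^sub>C U)
      = (I 1 \<otimes>\<^sub>C A) \<circ>\<^sub>C ((- z) \<odot>\<^sub>C (U \<otimes>\<^sub>C I 1) \<oplus>\<^sub>C (I 1 \<otimes>\<^sub>C H) \<circ>\<^sub>C (U \<otimes>\<^sub>C I 1) \<oplus>\<^sub>C z \<odot>\<^sub>C (I 1 \<otimes>\<^sub>C U))"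
    using cup_slide [OF assms(1)] assms(2) by (simp add: comp_assoc)
  \<comment> \<open>The deleted rule would turn \<open>- z + v\<close> into \<open>v - z\<close>,
    which \<open>add_scale\<close> cannot split.\<close>
  ultimately have "(I 1 \<otimes>\<^sub>C A) \<circ>\<^sub>C (H \<otimes>\<^sub>C I 1) \<circ>\<^sub>C (I 1 \<otimes>\<^sub>C U) = (- z + v + z * \<delta>) \<odot>\<^sub>C I 1"
    using zigzag by (simp add: add_scale del: uminus_add_conv_diff flip: comp_assoc)
  \<comment> \<open>The left side is \<open>v + z * (\<delta> - 1)\<close>, so the condition on the
    parameters applies.\<close>
  also have "- z + v + z * \<delta> = inverse v"
    using assms(5) by (simp add: algebra_simps)
  finally show ?thesis .
qed

end

section \<open>The two presentations\<close>

lemma numeric_presented_category: "numeric_category (presented_category P)"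
  by (intro numeric_category.intro presented_category_is_category) (unfold_locales, auto)

text \<open>Oriented opposite to \<open>presented_category_ops\<close>, so that a relation between
  terms becomes an equation between diagrams in the classes of the generators.\<close>

lemma mor_class_operations:
  "mor_class P (Idt n) = ident (presented_category P) n"
  "well_formed P (g \<cdot> f) \<Longrightarrow> mor_class P (g \<cdot> f) =
     compose (presented_category P) (mor_class P g) (mor_class P f)"
  "well_formed P (f \<otimes> g) \<Longrightarrow> mor_class P (f \<otimes> g) =
     tensor (presented_category P) (mor_class P f) (mor_class P g)"
  "well_formed P (f \<oplus> g) \<Longrightarrow> mor_class P (f \<oplus> g) =
     hom_add (presented_category P) (mor_class P f) (mor_class P g)"
  "well_formed P f \<Longrightarrow> mor_class P (x \<odot> f) =
     hom_scale (presented_category P) x (mor_class P f)"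
  by (simp_all add: presented_category_ops)

text \<open>This rule would turn \<open>ident\<close> back into a class and loop with the first rule
  of \<open>mor_class_operations\<close>.\<close>

declare presented_category_simps(5) [simp del]

lemma arr_mor_class:
  assumes "well_formed P f"
  shows "numeric_category.arr (presented_category P) (mor_class P f)"
    and "numeric_category.src (presented_category P) (mor_class P f) = term_source P f"
    and "numeric_category.tgt (presented_category P) (mor_class P f) = term_target P f"
proof -
  interpret numeric_category "presented_category P"
    by (rule numeric_presented_category)
  have "mor_class P f \<in> Hom (presented_category P) (term_source P f) (term_target P f)"
    using assms by (auto simp: typed_iff)
  from hom_src_tgt [OF this]
  show "arr (mor_class P f)" "src (mor_class P f) = term_source P f"
    "tgt (mor_class P f) = term_target P f" by auto
qed

lemma brauer_presentation_simps [simp]: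
  "gen_source (brauer_presentation v z \<delta>) g = (case g of BrU \<Rightarrow> 0 | _ \<Rightarrow> 2)"
  "gen_target (brauer_presentation v z \<delta>) g = (case g of BrA \<Rightarrow> 0 | _ \<Rightarrow> 2)"
  "relations (brauer_presentation v z \<delta>) = brauer_relations v z \<delta>"
  by (simp_all add: brauer_presentation_def split: brauer_gen.split)

lemma bwm_presentation_simps [simp]:
  "gen_source (bwm_presentation v z \<delta>) g = (case g of BwU \<Rightarrow> 0 | _ \<Rightarrow> 2)"
  "gen_target (bwm_presentation v z \<delta>) g = (case g of BwA \<Rightarrow> 0 | _ \<Rightarrow> 2)"
  "relations (bwm_presentation v z \<delta>) = bwm_relations v z \<delta>"
  by (simp_all add: bwm_presentation_def split: bwm_gen.split)

lemma brauer_class_eq: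
  assumes "(f, g) \<in> brauer_relations v z \<delta>"
  shows "mor_class (brauer_presentation v z \<delta>) f = mor_class (brauer_presentation v z \<delta>) g"
  using assms brauer_relations_typed [of f g v z \<delta>] mor_eq.mor_relation mor_class_eqI
  by (metis brauer_presentation_simps(3))

lemma bwm_class_eq:
  assumes "(f, g) \<in> bwm_relations v z \<delta>"
  shows "mor_class (bwm_presentation v z \<delta>) f = mor_class (bwm_presentation v z \<delta>) g"
  using assms bwm_relations_typed [of f g v z \<delta>] mor_eq.mor_relation mor_class_eqI
  by (metis bwm_presentation_simps(3))

section \<open>The two maps of presentations\<close>

definition bwm_of_brauer :: "brauer_gen \<Rightarrow> bwm_gen" where
  "bwm_of_brauer g = (case g of BrH \<Rightarrow> BwH | BrHinv \<Rightarrow> BwHbar | BrA \<Rightarrow> BwA | BrU \<Rightarrow> BwU)"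

definition brauer_of_bwm :: "bwm_gen \<Rightarrow> brauer_gen" where
  "brauer_of_bwm g = (case g of BwH \<Rightarrow> BrH | BwHbar \<Rightarrow> BrHinv | BwA \<Rightarrow> BrA | BwU \<Rightarrow> BrU)"

lemma brauer_to_bwm:
  fixes v z \<delta> :: "'k::field"
  assumes "v \<noteq> 0"
  shows "presentation_map (brauer_presentation v z \<delta>) (bwm_presentation v z \<delta>) bwm_of_brauer"
proof
  let ?Q = "bwm_presentation v z \<delta>"
  interpret numeric_category "presented_category ?Q"
    by (rule numeric_presented_category)
  note mor_class_operations [simp]
  \<comment> \<open>The facts \<open>eqs\<close> follow the order of the introduction rules, each
    read as an equation in the quotient.\<close>
  note eqs = bwm_relations.intros [where v = v and z = z and \<delta> = \<delta>, THEN bwm_class_eq, simplified]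
  interpret crossing_category "presented_category ?Q"
      "mor_class ?Q bwA" "mor_class ?Q bwU" "mor_class ?Q bwH" "mor_class ?Q bwHbar" v z
    by unfold_locales (simp_all add: arr_mor_class assms eqs)
  note quadratic = skein_iff_quadratic [THEN iffD1, OF eqs(1)]
  \<comment> \<open>\<open>eqs(11)\<close> trades the cup crossed by \<open>H\<close> for the cup
    crossed by \<open>K\<close> on the other side, which \<open>cup_slide\<close> expands into three
    terms; \<open>cap\<close> is the rotated analogue.\<close>
  note cup = trans [OF pull_cup_right_iff [THEN iffD1, OF eqs(11), symmetric] cup_slide [OF eqs(1)]]
  note cap = trans [OF pull_cap(1) [OF eqs(10,11), symmetric] cap_slide [OF eqs(1)]]
  show "mor_class ?Q (rename bwm_of_brauer f) = mor_class ?Q (rename bwm_of_brauer g)"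
    if "(f, g) \<in> relations (brauer_presentation v z \<delta>)" for f g
    using that unfolding brauer_presentation_simps
    by cases (simp_all add: bwm_of_brauer_def eqs quadratic cup cap pull_cap(2) [OF eqs(10,11)])
qed (simp_all add: bwm_of_brauer_def split: brauer_gen.split)

lemma bwm_to_brauer:
  fixes v z \<delta> :: "'k::field"
  assumes "v \<noteq> 0" "inverse v - v = z * (\<delta> - 1)"
  shows "presentation_map (bwm_presentation v z \<delta>) (brauer_presentation v z \<delta>) brauer_of_bwm"
proof
  let ?Q = "brauer_presentation v z \<delta>"
  interpret numeric_category "presented_category ?Q"
    by (rule numeric_presented_category)
  note mor_class_operations [simp]
  note eqs = brauer_relations.intros [where v = v and z = z and \<delta> = \<delta>, THEN brauer_class_eq, simplified]
  interpret crossing_category "presented_category ?Q"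
      "mor_class ?Q brA" "mor_class ?Q brU" "mor_class ?Q brH" "mor_class ?Q brHinv" v z
    by unfold_locales (simp_all add: arr_mor_class assms eqs)
  note skein = skein_iff_quadratic [THEN iffD2, OF eqs(9)]
  \<comment> \<open>The right sides of \<open>cup_slide\<close> and of the three-term relation
    \<open>eqs(10)\<close> agree, hence so do the left sides.\<close>
  note cup = trans [OF cup_slide [OF skein] eqs(10) [symmetric]]
  \<comment> \<open>Together with \<open>skein\<close>, these are the relations of the BWM-category
    missing from the other list.\<close>
  note right = pull_cup_right_iff [THEN iffD2, OF cup] curl [OF skein cup eqs(4,5) assms(2)]
  show "mor_class ?Q (rename brauer_of_bwm f) = mor_class ?Q (rename brauer_of_bwm g)"
    if "(f, g) \<in> relations (bwm_presentation v z \<delta>)" for f g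
    using that unfolding bwm_presentation_simps
    by cases (simp_all add: brauer_of_bwm_def eqs(1-8,11,14) skein right)
qed (simp_all add: brauer_of_bwm_def split: bwm_gen.split)

theorem proposition10p3:
  fixes v z \<delta> :: "'k::field"
  assumes "CHAR('k) \<noteq> 2"
    and "v \<noteq> 0" and "z \<noteq> 0"
    and "inverse v - v = z * (\<delta> - 1)"
  shows "strict_monoidal_isomorphic (brauer_category v z \<delta>) (bwm_category v z \<delta>)"
  unfolding brauer_category_def bwm_category_def
  using brauer_to_bwm [OF assms(2)] bwm_to_brauer [OF assms(2,4)]
  by (rule presentation_isomorphism)
    (simp_all add: brauer_of_bwm_def bwm_of_brauer_def split: brauer_gen.split bwm_gen.split)

end
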